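(* Let $r\ge 3$ and $\ell\ge 2$ be fixed integers. If $p=p(n)$ satisfies \[ \frac{1}{n^{r-1+1/\ell}} \ll p \ll \frac{1}{n^{r-1+1/(\ell+1)}}, \] then a.a.s. $\ell_{\max} = \ell$, where $\ell_{\max}$ is the maximal length of an ordered loose path in the random $r$-uniform hypergraph $H^{(r)}(n,p)$. Furthermore, let $c>0$ be a real number and let $p=c/n^{r-1+1/\ell}$. Let $X$ be the number of ordered loose paths of length $\ell$ in $H^{(r)}(n,p)$. Then $X$ converges in distribution, as $n\to\infty$, to the Poisson distribution $\mathrm{Po}(\lambda)$, where \[ \lambda = \frac{c^\ell}{(\ell(r-1)+1)!}. \]
   Context: $H=H^{(r)}(n,p)$ is the random $r$-uniform hypergraph on the vertex set $[n]=\{1,\dots,n\}$ in which each $r$-element subset of $[n]$ is included as an edge independently with probability $p=p(n)\in[0,1]$. An ordered loose path of length $\ell$ in $H$ is an increasing sequence of vertices $v_1<v_2<\dots<v_{\ell(r-1)+1}$ in $[n]$ such that the $\ell$ sets $\{v_{(k-1)(r-1)+1},v_{(k-1)(r-1)+2},\dots,v_{k(r-1)+1}\}$, $k=1,\dots,\ell$, are all edges of $H$ (so every two consecutive edges intersect in a single vertex). $\ell_{\max}$ denotes the maximal length of an ordered loose path in $H$. All asymptotics are as $n\to\infty$; "a.a.s." means with probability tending to $1$ as $n\to\infty$. $A_n\ll B_n$ means $A_n/B_n\to0$ as $n\to\infty$. *)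

theory Defs
  imports "HOL-Probability.Probability"
begin

text \<open>
  A hypergraph on the vertex set \<open>{1..n}\<close> is represented by its set of edges.
\<close>

definition r_subsets :: "nat \<Rightarrow> nat \<Rightarrow> nat set set" where
  "r_subsets r n = {e. e \<subseteq> {1..n} \<and> card e = r}"

definition random_hypergraph :: "nat \<Rightarrow> nat \<Rightarrow> real \<Rightarrow> nat set set pmf" where
  "random_hypergraph r n p =
     map_pmf (\<lambda>f. {e \<in> r_subsets r n. f e})
       (Pi_pmf (r_subsets r n) False (\<lambda>_. bernoulli_pmf p))"

text \<open>
  The list positions are counted from \<open>0\<close>, so that the vertex \<open>v\<^sub>i\<close> is \<open>vs ! (i - 1)\<close> and
  the edges are numbered by \<open>k = 0, \<dots>, l - 1\<close>.
  The length is the number of edges; a path of length \<open>0\<close> is a single vertex.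
\<close>

definition ordered_loose_path ::
    "nat \<Rightarrow> nat \<Rightarrow> nat set set \<Rightarrow> nat \<Rightarrow> nat list \<Rightarrow> bool" where
  "ordered_loose_path r n H l vs \<longleftrightarrow>
     length vs = l * (r - 1) + 1 \<and> set vs \<subseteq> {1..n} \<and> sorted_wrt (<) vs \<and>
     (\<forall>k<l. (\<lambda>i. vs ! i) ` {k * (r - 1)..(k + 1) * (r - 1)} \<in> H)"

definition num_ordered_loose_paths :: "nat \<Rightarrow> nat \<Rightarrow> nat \<Rightarrow> nat set set \<Rightarrow> nat" where
  "num_ordered_loose_paths r n l H = card {vs. ordered_loose_path r n H l vs}"

text \<open>
  For \<open>r \<ge> 2\<close> and \<open>n \<ge> 1\<close> the set of lengths below is finite and contains \<open>0\<close>, so the maximum is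
  a proper one, also if \<open>H\<close> has no edges.
\<close>

definition l_max :: "nat \<Rightarrow> nat \<Rightarrow> nat set set \<Rightarrow> nat" where
  "l_max r n H = Max {l. \<exists>vs. ordered_loose_path r n H l vs}"

text \<open>
  \<open>A\<^sub>n / B\<^sub>n \<longlonglongrightarrow> 0\<close>. The first conjunct says that the quotient is meaningful for large \<open>n\<close>; without
  it the convention \<open>x / 0 = 0\<close> would make \<open>much_less A (\<lambda>_. 0)\<close> true.
\<close>

definition much_less :: "(nat \<Rightarrow> real) \<Rightarrow> (nat \<Rightarrow> real) \<Rightarrow> bool" where
  "much_less A B \<longleftrightarrow>
     (\<forall>\<^sub>F n in sequentially. B n \<noteq> 0) \<and> (\<lambda>n. A n / B n) \<longlonglongrightarrow> 0"

definition aas :: "(nat \<Rightarrow> 'a pmf) \<Rightarrow> (nat \<Rightarrow> 'a \<Rightarrow> bool) \<Rightarrow> bool" where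
  "aas M P \<longleftrightarrow> (\<lambda>n. measure_pmf.prob (M n) {x. P n x}) \<longlonglongrightarrow> 1"

definition converges_in_distribution ::
    "(nat \<Rightarrow> 'a pmf) \<Rightarrow> (nat \<Rightarrow> 'a \<Rightarrow> nat) \<Rightarrow> nat pmf \<Rightarrow> bool" where
  "converges_in_distribution M X L \<longleftrightarrow>
     weak_conv_m (\<lambda>n. distr (measure_pmf (M n)) borel (\<lambda>x. real (X n x)))
                 (distr (measure_pmf L) borel real)"

end

theory Submission
  imports Defs
begin

text \<open>
  Write \<open>m = l (r - 1) + 1\<close>. Ordered loose paths of length \<open>l\<close> correspond to \<open>m\<close>-subsets of
  \<open>{1..n}\<close>, so their expected number is \<open>(n choose m) p ^ l\<close>. Since \<open>j \<ge> 1\<close> edges of a loose path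
  cover at least \<open>j (r - 1) + 1\<close> vertices, the pairs of paths sharing exactly \<open>j\<close> edges contribute
  at most a constant times \<open>(n ^ m p ^ l)\<^sup>2 / (n ^ (j (r - 1) + 1) p ^ j)\<close> to the second moment.
  In the first regime this is negligible against the squared mean for all \<open>j \<le> l\<close>, so Chebyshev
  gives a path of length \<open>l\<close>, and Markov excludes one of length \<open>l + 1\<close>. For
  \<open>p = c / n powr (r - 1 + 1 / l)\<close> the terms with \<open>j < l\<close> tend to \<open>0\<close>, and the Chen--Stein
  method with neighbourhoods of edge-sharing paths gives the Poisson limit.
\<close>

section \<open>Random subsets and the Chen--Stein method\<close>

definition random_subset :: "'a set \<Rightarrow> real \<Rightarrow> 'a set pmf" where
  "random_subset R p = map_pmf (\<lambda>f. {e \<in> R. f e}) (Pi_pmf R False (\<lambda>_. bernoulli_pmf p))"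

lemma set_random_subset: "set_pmf (random_subset R p) \<subseteq> Pow R"
  by (auto simp: random_subset_def)

lemma integrable_random_subset [simp]:
  fixes f :: "'a set \<Rightarrow> real"
  assumes "finite R"
  shows "integrable (measure_pmf (random_subset R p)) f"
  by (rule integrable_measure_pmf_finite, rule finite_subset[OF set_random_subset])
     (use assms in simp)

lemma random_subset_Un:
  assumes "finite A" "finite B" "A \<inter> B = {}"
  shows "random_subset (A \<union> B) p =
           map_pmf (\<lambda>(X, Y). X \<union> Y) (pair_pmf (random_subset A p) (random_subset B p))"
proof -
  have "random_subset (A \<union> B) p =
      map_pmf (\<lambda>(f, g). {e \<in> A \<union> B. if e \<in> A then f e else g e})
        (pair_pmf (Pi_pmf A False (\<lambda>_. bernoulli_pmf p)) (Pi_pmf B False (\<lambda>_. bernoulli_pmf p)))"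
    by (simp only: random_subset_def Pi_pmf_union[OF assms] map_pmf_comp case_prod_unfold)
  also have "(\<lambda>(f, g). {e \<in> A \<union> B. if e \<in> A then f e else g e}) =
      (\<lambda>z. (\<lambda>(X, Y). X \<union> Y) ((\<lambda>(f, g). ({e \<in> A. f e}, {e \<in> B. g e})) z))"
    using assms(3) by (auto simp: fun_eq_iff)
  also have "map_pmf \<dots> (pair_pmf (Pi_pmf A False (\<lambda>_. bernoulli_pmf p)) (Pi_pmf B False (\<lambda>_. bernoulli_pmf p))) =
      map_pmf (\<lambda>(X, Y). X \<union> Y) (pair_pmf (random_subset A p) (random_subset B p))"
    unfolding random_subset_def map_pair[symmetric] map_pmf_comp ..
  finally show ?thesis .
qed

lemma pmf_random_subset_full:
  assumes "finite R" "0 \<le> p" "p \<le> 1"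
  shows "pmf (random_subset R p) R = p ^ card R"
proof -
  have "pmf (random_subset R p) R =
      measure_pmf.prob (Pi_pmf R False (\<lambda>_. bernoulli_pmf p)) (Pi R (\<lambda>_. {True}))"
    by (simp add: random_subset_def pmf_map vimage_def Pi_def)
       (rule arg_cong[where f = "measure_pmf.prob _"], auto)
  also have "\<dots> = p ^ card R"
    using assms by (simp add: measure_Pi_pmf_Pi measure_pmf_single)
  finally show ?thesis .
qed

text \<open>The traces of the random set on \<open>F\<close> and on \<open>R - F\<close> are
  independent, and \<open>h (H - F)\<close> sees only the second one. In the double sum over both
  traces, the indicator leaves only \<open>X = F\<close>, of weight \<open>p ^ card F\<close>.
  Independence enters the later arguments in this form.\<close>

lemma expectation_random_subset_split:
  fixes h :: "'a set \<Rightarrow> real"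
  assumes R: "finite R" and p: "0 \<le> p" "p \<le> 1" and F: "F \<subseteq> R"
  shows "measure_pmf.expectation (random_subset R p) (\<lambda>H. of_bool (F \<subseteq> H) * h (H - F)) =
         p ^ card F * measure_pmf.expectation (random_subset R p) (\<lambda>H. h (H - F))"
proof -
  define P Q where "P = random_subset F p" and "Q = random_subset (R - F) p"
  have fin: "finite F" "finite (R - F)"
    using R F finite_subset by auto
  have setP: "set_pmf P \<subseteq> Pow F" and setQ: "set_pmf Q \<subseteq> Pow (R - F)"
    unfolding P_def Q_def by (rule set_random_subset)+
  have D: "random_subset R p = map_pmf (\<lambda>(X, Y). X \<union> Y) (pair_pmf P Q)"
    using random_subset_Un[OF fin, of p] F by (simp add: P_def Q_def Un_absorb1)
  have E: "measure_pmf.expectation (random_subset R p) f =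
      (\<Sum>X\<in>Pow F. \<Sum>Y\<in>Pow (R - F). f (X \<union> Y) * (pmf P X * pmf Q Y))" for f :: "'a set \<Rightarrow> real"
  proof -
    have "measure_pmf.expectation (random_subset R p) f =
        (\<Sum>z\<in>Pow F \<times> Pow (R - F). f (fst z \<union> snd z) * pmf (pair_pmf P Q) z)"
      unfolding D integral_map_pmf
      by (subst integral_measure_pmf_real[of "Pow F \<times> Pow (R - F)"])
         (use fin setP setQ in \<open>auto simp: case_prod_unfold\<close>)
    also have "\<dots> = (\<Sum>X\<in>Pow F. \<Sum>Y\<in>Pow (R - F). f (X \<union> Y) * (pmf P X * pmf Q Y))"
      by (simp add: sum.cartesian_product case_prod_unfold pmf_pair[symmetric])
    finally show ?thesis .
  qed
  have diff: "X \<union> Y - F = Y" if "X \<in> Pow F" "Y \<in> Pow (R - F)" for X Y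
    using that by auto
  define S where "S = (\<Sum>Y\<in>Pow (R - F). h Y * pmf Q Y)"
  have "measure_pmf.expectation (random_subset R p) (\<lambda>H. of_bool (F \<subseteq> H) * h (H - F)) =
      (\<Sum>X\<in>Pow F. \<Sum>Y\<in>Pow (R - F). (if X = F then h Y * pmf Q Y * pmf P F else 0))"
    unfolding E
    by (intro sum.cong refl) (use diff in \<open>auto simp: mult_ac subset_antisym\<close>)
  also have "\<dots> = (\<Sum>X\<in>Pow F. if X = F then S * pmf P F else 0)"
    by (intro sum.cong refl) (auto simp: S_def sum_distrib_right)
  also have "\<dots> = S * pmf P F"
    using fin by simp
  also have "pmf P F = p ^ card F"
    unfolding P_def using fin p by (intro pmf_random_subset_full)
  finally have 1: "measure_pmf.expectation (random_subset R p) (\<lambda>H. of_bool (F \<subseteq> H) * h (H - F)) =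
      S * p ^ card F" .
  have "measure_pmf.expectation (random_subset R p) (\<lambda>H. h (H - F)) =
      (\<Sum>X\<in>Pow F. \<Sum>Y\<in>Pow (R - F). pmf P X * (h Y * pmf Q Y))"
    unfolding E by (intro sum.cong refl) (use diff in \<open>simp add: mult_ac\<close>)
  also have "\<dots> = (\<Sum>X\<in>Pow F. pmf P X) * S"
    unfolding S_def sum_product ..
  also have "(\<Sum>X\<in>Pow F. pmf P X) = 1"
    using fin setP by (intro sum_pmf_eq_1) auto
  finally show ?thesis
    using 1 by simp
qed

lemma expectation_random_subset_supset:
  assumes "finite R" "0 \<le> p" "p \<le> 1" "F \<subseteq> R"
  shows "measure_pmf.expectation (random_subset R p) (\<lambda>H. of_bool (F \<subseteq> H)) = p ^ card F"
  using expectation_random_subset_split[OF assms, of "\<lambda>_. 1"] by simp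

section \<open>The Chen--Stein estimate for sums of dependent indicators\<close>

lemma telescope_bound:
  fixes g :: "nat \<Rightarrow> real"
  assumes "\<And>k. \<bar>g k\<bar> \<le> B" "a \<le> b"
  shows "\<bar>g b - g a\<bar> \<le> 2 * B * real (b - a)"
proof (cases "a = b")
  case False
  \<comment> \<open>The bound \<open>2 * B\<close> is weakened to one linear in
    \<open>b - a \<ge> 1\<close>, because \<open>b - a\<close> will be a count of neighbours, whose
    expectation is a plain sum of powers of \<open>p\<close>.\<close>
  have "\<bar>g b - g a\<bar> \<le> 2 * B * 1"
    using assms(1)[of a] assms(1)[of b] by linarith
  also have "\<dots> \<le> 2 * B * real (b - a)"
    using False assms(1)[of a] assms(2) by (intro mult_left_mono) auto
  finally show ?thesis .
qed simp

locale random_subset_family =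
  fixes R :: "'a set" and p :: real and I :: "'i set" and E :: "'i \<Rightarrow> 'a set" and l :: nat
  assumes finite_R: "finite R" and p_nonneg: "0 \<le> p" and p_le_1: "p \<le> 1"
    and finite_I: "finite I" and l_pos: "l > 0"
    and E_subset: "\<And>\<alpha>. \<alpha> \<in> I \<Longrightarrow> E \<alpha> \<subseteq> R" and card_E: "\<And>\<alpha>. \<alpha> \<in> I \<Longrightarrow> card (E \<alpha>) = l"
begin

abbreviation "D \<equiv> random_subset R p"
abbreviation "expect \<equiv> measure_pmf.expectation D"

definition W :: "'a set \<Rightarrow> nat" where "W H = card {\<alpha> \<in> I. E \<alpha> \<subseteq> H}"

text \<open>The dependency neighbourhood: the event for \<open>\<alpha>\<close> is independent of
  all events for indices outside it taken together.\<close>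

definition nbhd :: "'i \<Rightarrow> 'i set" where "nbhd \<alpha> = {\<beta> \<in> I. E \<beta> \<inter> E \<alpha> \<noteq> {}}"

lemma integrable [simp]: "integrable (measure_pmf D) (f :: _ \<Rightarrow> real)"
  using finite_R by simp

lemma W_eq: "real (W H) = (\<Sum>\<alpha>\<in>I. of_bool (E \<alpha> \<subseteq> H))"
  using finite_I by (simp add: W_def sum.If_cases of_bool_def Collect_conj_eq)

lemma expect_E: "\<alpha> \<in> I \<Longrightarrow> expect (\<lambda>H. of_bool (E \<alpha> \<subseteq> H)) = p ^ l"
  using expectation_random_subset_supset[OF finite_R p_nonneg p_le_1 E_subset] card_E by simp

lemma expect_E2:
  "\<alpha> \<in> I \<Longrightarrow> \<beta> \<in> I \<Longrightarrow>
     expect (\<lambda>H. of_bool (E \<alpha> \<subseteq> H) * of_bool (E \<beta> \<subseteq> H)) = p ^ card (E \<alpha> \<union> E \<beta>)"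
  using expectation_random_subset_supset[OF finite_R p_nonneg p_le_1, of "E \<alpha> \<union> E \<beta>"] E_subset
  by (simp add: of_bool_conj)

lemma expect_W: "expect (\<lambda>H. real (W H)) = real (card I) * p ^ l"
  by (simp add: W_eq expect_E)

lemma mem_nbhd: "\<alpha> \<in> I \<Longrightarrow> \<alpha> \<in> nbhd \<alpha>"
  using card_E[of \<alpha>] l_pos by (auto simp: nbhd_def)

lemma nbhd_subset: "nbhd \<alpha> \<subseteq> I" and finite_nbhd: "finite (nbhd \<alpha>)"
  using finite_I by (auto simp: nbhd_def)

text \<open>Both values of \<open>g\<close> are compared with \<open>g (Suc (Z H))\<close>, where
  \<open>Z\<close> counts the sets outside the neighbourhood. The two reference terms have equal
  expectations by independence and cancel. The remaining increments of \<open>g\<close> are over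
  numbers of neighbours contained in \<open>H\<close>, which yields the two error sums.\<close>

lemma stein_summand:
  fixes g :: "nat \<Rightarrow> real"
  assumes g: "\<And>k. \<bar>g k\<bar> \<le> B" and \<alpha>: "\<alpha> \<in> I"
  shows "\<bar>expect (\<lambda>H. p ^ l * g (Suc (W H)) - of_bool (E \<alpha> \<subseteq> H) * g (W H))\<bar>
     \<le> 2 * B * (p ^ l * (real (card (nbhd \<alpha>)) * p ^ l) + (\<Sum>\<beta>\<in>nbhd \<alpha> - {\<alpha>}. p ^ card (E \<alpha> \<union> E \<beta>)))"
proof -
  \<comment> \<open>\<open>Z\<close> only looks at edges outside \<open>E \<alpha>\<close>, so it is independent of the event \<open>E \<alpha> \<subseteq> H\<close>.\<close>
  define Z where "Z H = card {\<beta> \<in> I - nbhd \<alpha>. E \<beta> \<subseteq> H}" for H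
  have Z_diff: "Z (H - E \<alpha>) = Z H" for H
    unfolding Z_def by (rule arg_cong[where f = card]) (auto simp: nbhd_def)
  have W_Z: "W H = Z H + card {\<beta> \<in> nbhd \<alpha>. E \<beta> \<subseteq> H}" for H
  proof -
    have "{\<beta> \<in> I. E \<beta> \<subseteq> H} = {\<beta> \<in> I - nbhd \<alpha>. E \<beta> \<subseteq> H} \<union> {\<beta> \<in> nbhd \<alpha>. E \<beta> \<subseteq> H}"
      using nbhd_subset by auto
    then show ?thesis
      unfolding W_def Z_def using finite_I finite_nbhd by (simp add: card_Un_disjoint disjoint_iff)
  qed
  have cnt: "real (card {\<beta> \<in> N. E \<beta> \<subseteq> H}) = (\<Sum>\<beta>\<in>N. of_bool (E \<beta> \<subseteq> H))" if "finite N" for N H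
    using that by (simp add: sum.If_cases of_bool_def Collect_conj_eq)
  have B: "B \<ge> 0" using g[of 0] by linarith
  have 1: "expect (\<lambda>H. of_bool (E \<alpha> \<subseteq> H) * g (Suc (Z H))) = p ^ l * expect (\<lambda>H. g (Suc (Z H)))"
    using expectation_random_subset_split[OF finite_R p_nonneg p_le_1 E_subset[OF \<alpha>],
        of "\<lambda>H. g (Suc (Z H))"] card_E[OF \<alpha>] by (simp add: Z_diff)
  have "expect (\<lambda>H. p ^ l * g (Suc (W H)) - of_bool (E \<alpha> \<subseteq> H) * g (W H)) =
      expect (\<lambda>H. p ^ l * (g (Suc (W H)) - g (Suc (Z H)))
        - of_bool (E \<alpha> \<subseteq> H) * (g (W H) - g (Suc (Z H))))"
    using 1 by (simp add: right_diff_distrib)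
  also have "\<bar>\<dots>\<bar> \<le> expect (\<lambda>H. \<bar>p ^ l * (g (Suc (W H)) - g (Suc (Z H)))
        - of_bool (E \<alpha> \<subseteq> H) * (g (W H) - g (Suc (Z H)))\<bar>)"
    by (rule integral_abs_bound)
  also have "\<dots> \<le> expect (\<lambda>H. 2 * B * (p ^ l * (\<Sum>\<beta>\<in>nbhd \<alpha>. of_bool (E \<beta> \<subseteq> H)) +
        (\<Sum>\<beta>\<in>nbhd \<alpha> - {\<alpha>}. of_bool (E \<alpha> \<subseteq> H) * of_bool (E \<beta> \<subseteq> H))))"
  proof (rule integral_mono)
    fix H
    have "\<bar>g (Suc (W H)) - g (Suc (Z H))\<bar> \<le> 2 * B * real (card {\<beta> \<in> nbhd \<alpha>. E \<beta> \<subseteq> H})"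
      using telescope_bound[of g B "Suc (Z H)" "Suc (W H)"] g W_Z[of H] by simp
    then have a: "\<bar>p ^ l * (g (Suc (W H)) - g (Suc (Z H)))\<bar> \<le>
        2 * B * (p ^ l * (\<Sum>\<beta>\<in>nbhd \<alpha>. of_bool (E \<beta> \<subseteq> H)))"
      using p_nonneg finite_nbhd
      by (simp add: abs_mult cnt mult.left_commute[of _ "p ^ l"] mult_left_mono)
    have b: "\<bar>of_bool (E \<alpha> \<subseteq> H) * (g (W H) - g (Suc (Z H)))\<bar> \<le>
        2 * B * (\<Sum>\<beta>\<in>nbhd \<alpha> - {\<alpha>}. of_bool (E \<alpha> \<subseteq> H) * of_bool (E \<beta> \<subseteq> H))"
    proof (cases "E \<alpha> \<subseteq> H")
      case True
      \<comment> \<open>On this event \<open>\<alpha>\<close> itself accounts for the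
        \<open>Suc\<close>. Hence the diagonal term is absent from the second sum; it would
        contribute the whole mean after summation over \<open>\<alpha>\<close>.\<close>
      have "{\<beta> \<in> nbhd \<alpha>. E \<beta> \<subseteq> H} = insert \<alpha> {\<beta> \<in> nbhd \<alpha> - {\<alpha>}. E \<beta> \<subseteq> H}"
        using True mem_nbhd[OF \<alpha>] by auto
      then have "card {\<beta> \<in> nbhd \<alpha>. E \<beta> \<subseteq> H} = Suc (card {\<beta> \<in> nbhd \<alpha> - {\<alpha>}. E \<beta> \<subseteq> H})"
        using finite_nbhd by simp
      then have "W H - Suc (Z H) = card {\<beta> \<in> nbhd \<alpha> - {\<alpha>}. E \<beta> \<subseteq> H}" "Suc (Z H) \<le> W H"
        using W_Z[of H] by auto
      then show ?thesis
        using telescope_bound[of g B "Suc (Z H)" "W H"] g True cnt[of "nbhd \<alpha> - {\<alpha>}" H] finite_nbhd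
        by simp
    qed (use B in simp)
    show "\<bar>p ^ l * (g (Suc (W H)) - g (Suc (Z H)))
        - of_bool (E \<alpha> \<subseteq> H) * (g (W H) - g (Suc (Z H)))\<bar> \<le>
        2 * B * (p ^ l * (\<Sum>\<beta>\<in>nbhd \<alpha>. of_bool (E \<beta> \<subseteq> H)) +
        (\<Sum>\<beta>\<in>nbhd \<alpha> - {\<alpha>}. of_bool (E \<alpha> \<subseteq> H) * of_bool (E \<beta> \<subseteq> H)))"
      using a b unfolding distrib_left[of "2 * B"] by linarith
  qed simp_all
  also have "\<dots> = 2 * B * (p ^ l * (\<Sum>\<beta>\<in>nbhd \<alpha>. expect (\<lambda>H. of_bool (E \<beta> \<subseteq> H))) +
        (\<Sum>\<beta>\<in>nbhd \<alpha> - {\<alpha>}. expect (\<lambda>H. of_bool (E \<alpha> \<subseteq> H) * of_bool (E \<beta> \<subseteq> H))))"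
    by simp
  also have "(\<Sum>\<beta>\<in>nbhd \<alpha>. expect (\<lambda>H. of_bool (E \<beta> \<subseteq> H))) = (\<Sum>\<beta>\<in>nbhd \<alpha>. p ^ l)"
    using nbhd_subset by (intro sum.cong refl expect_E) auto
  also have "(\<Sum>\<beta>\<in>nbhd \<alpha> - {\<alpha>}. expect (\<lambda>H. of_bool (E \<alpha> \<subseteq> H) * of_bool (E \<beta> \<subseteq> H))) =
      (\<Sum>\<beta>\<in>nbhd \<alpha> - {\<alpha>}. p ^ card (E \<alpha> \<union> E \<beta>))"
    using nbhd_subset \<alpha> by (intro sum.cong refl expect_E2) auto
  finally show ?thesis
    by simp
qed

text \<open>\<open>W\<close> is split into its indicators and \<open>stein_summand\<close> is
  applied to each. The gap between \<open>\<theta>\<close> and the true mean is charged separately,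
  so that one Poisson parameter can serve for means that merely converge to it.\<close>

lemma stein_bound:
  fixes g :: "nat \<Rightarrow> real"
  assumes g: "\<And>k. \<bar>g k\<bar> \<le> B"
  shows "\<bar>expect (\<lambda>H. \<theta> * g (Suc (W H)) - real (W H) * g (W H))\<bar> \<le>
    B * \<bar>\<theta> - real (card I) * p ^ l\<bar> +
    2 * B * ((\<Sum>\<alpha>\<in>I. real (card (nbhd \<alpha>))) * p ^ (2 * l) +
             (\<Sum>\<alpha>\<in>I. \<Sum>\<beta>\<in>nbhd \<alpha> - {\<alpha>}. p ^ card (E \<alpha> \<union> E \<beta>)))"
proof -
  define \<mu> where "\<mu> = real (card I) * p ^ l"
  have "(\<lambda>H. \<theta> * g (Suc (W H)) - real (W H) * g (W H)) = (\<lambda>H. (\<theta> - \<mu>) * g (Suc (W H)) +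
      (\<Sum>\<alpha>\<in>I. p ^ l * g (Suc (W H)) - of_bool (E \<alpha> \<subseteq> H) * g (W H)))"
    by (simp add: fun_eq_iff W_eq sum_subtractf sum_distrib_right[symmetric] \<mu>_def left_diff_distrib)
  then have "expect (\<lambda>H. \<theta> * g (Suc (W H)) - real (W H) * g (W H)) =
      (\<theta> - \<mu>) * expect (\<lambda>H. g (Suc (W H))) +
      (\<Sum>\<alpha>\<in>I. expect (\<lambda>H. p ^ l * g (Suc (W H)) - of_bool (E \<alpha> \<subseteq> H) * g (W H)))"
    by (simp only: Bochner_Integration.integral_add Bochner_Integration.integral_sum
        integrable_random_subset[OF finite_R] integral_mult_right_zero)
  also have "\<bar>\<dots>\<bar> \<le> \<bar>(\<theta> - \<mu>) * expect (\<lambda>H. g (Suc (W H)))\<bar> +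
      (\<Sum>\<alpha>\<in>I. \<bar>expect (\<lambda>H. p ^ l * g (Suc (W H)) - of_bool (E \<alpha> \<subseteq> H) * g (W H))\<bar>)"
    by (rule order_trans[OF abs_triangle_ineq add_left_mono[OF sum_abs]])
  also have "\<dots> \<le> B * \<bar>\<theta> - \<mu>\<bar> + (\<Sum>\<alpha>\<in>I. 2 * B * (p ^ l * (real (card (nbhd \<alpha>)) * p ^ l) +
      (\<Sum>\<beta>\<in>nbhd \<alpha> - {\<alpha>}. p ^ card (E \<alpha> \<union> E \<beta>))))"
  proof (intro add_mono sum_mono stein_summand g)
    have "\<bar>expect (\<lambda>H. g (Suc (W H)))\<bar> \<le> expect (\<lambda>H. \<bar>g (Suc (W H))\<bar>)"
      by (rule integral_abs_bound)
    also have "\<dots> \<le> expect (\<lambda>H. B)"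
      by (intro integral_mono g) simp_all
    finally show "\<bar>(\<theta> - \<mu>) * expect (\<lambda>H. g (Suc (W H)))\<bar> \<le> B * \<bar>\<theta> - \<mu>\<bar>"
      using mult_left_mono[of _ B "\<bar>\<theta> - \<mu>\<bar>"] by (simp add: abs_mult mult.commute[of B])
  qed
  also have "(\<Sum>\<alpha>\<in>I. 2 * B * (p ^ l * (real (card (nbhd \<alpha>)) * p ^ l) +
      (\<Sum>\<beta>\<in>nbhd \<alpha> - {\<alpha>}. p ^ card (E \<alpha> \<union> E \<beta>)))) =
    2 * B * ((\<Sum>\<alpha>\<in>I. real (card (nbhd \<alpha>))) * p ^ (2 * l) +
             (\<Sum>\<alpha>\<in>I. \<Sum>\<beta>\<in>nbhd \<alpha> - {\<alpha>}. p ^ card (E \<alpha> \<union> E \<beta>)))"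
  proof -
    have "p ^ l * (x * p ^ l) = x * p ^ (2 * l)" for x
      by (simp add: mult_2 power_add)
    then show ?thesis
      by (simp only: sum_distrib_left[symmetric] sum_distrib_right[symmetric] sum.distrib)
  qed
  finally show ?thesis
    unfolding \<mu>_def .
qed

end

text \<open>
  \<open>g\<close> is the explicit solution of the Stein equation. Because the right-hand side has Poisson
  mean \<open>0\<close>, the partial sums \<open>\<Sum>i\<le>k. a i\<close> are minus a tail, which is what bounds \<open>g\<close>. The
  bound \<open>exp \<theta>\<close> is far from optimal but suffices for fixed \<open>\<theta>\<close>.
\<close>

lemma stein_solution:
  fixes \<theta> :: real and A :: "nat set"
  assumes \<theta>: "\<theta> > 0" and A: "finite A"
  obtains g :: "nat \<Rightarrow> real" where "\<And>k. \<bar>g k\<bar> \<le> exp \<theta>"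
    and "\<And>k. \<theta> * g (Suc k) - real k * g k =
               indicator A k - measure_pmf.prob (poisson_pmf \<theta>) A"
proof -
  define P where "P = measure_pmf.prob (poisson_pmf \<theta>) A"
  define f :: "nat \<Rightarrow> real" where "f k = indicator A k - P" for k
  define a where "a i = f i * (\<theta> ^ i / fact i)" for i
  \<comment> \<open>In the Stein equation at \<open>k = 0\<close> the value \<open>g 0\<close> has
    coefficient 0, so it is free; 0 keeps the bound trivial there.\<close>
  define g where "g k = (case k of 0 \<Rightarrow> 0 | Suc j \<Rightarrow> fact j / \<theta> ^ Suc j * (\<Sum>i\<le>j. a i))" for k
  have P: "0 \<le> P" "P \<le> 1"
    by (auto simp: P_def)
  have f_le: "\<bar>f k\<bar> \<le> 1" for k
    using P by (auto simp: f_def indicator_def)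
  have exp_sums: "(\<lambda>i. \<theta> ^ i / fact i) sums exp \<theta>"
    using exp_converges[of \<theta>] by (simp add: divide_inverse mult.commute)
  have "P = (\<Sum>i\<in>A. \<theta> ^ i / fact i * exp (- \<theta>))"
    unfolding P_def using \<theta> A by (simp add: measure_measure_pmf_finite)
  then have P_exp: "P * exp \<theta> = (\<Sum>i\<in>A. \<theta> ^ i / fact i)"
    by (simp only: sum_distrib_right[symmetric] mult.assoc exp_add[symmetric]) simp
  have "(\<lambda>i. (if i \<in> A then \<theta> ^ i / fact i else 0) - P * (\<theta> ^ i / fact i)) sums
      ((\<Sum>i\<in>A. \<theta> ^ i / fact i) - P * exp \<theta>)"
    by (intro sums_diff sums_If_finite_set A sums_mult exp_sums)
  also have "(\<lambda>i. (if i \<in> A then \<theta> ^ i / fact i else 0) - P * (\<theta> ^ i / fact i)) = a"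
    by (auto simp: fun_eq_iff a_def f_def left_diff_distrib diff_divide_distrib)
  finally have a_sums: "a sums 0"
    using P_exp by simp
  have bound: "\<bar>g (Suc k)\<bar> \<le> exp \<theta>" for k
  proof -
    \<comment> \<open>\<open>1 / C\<close> is the prefactor of the partial sum in
      \<open>g (Suc k)\<close>. Since \<open>fact k * fact n\<close> is at most
      \<open>fact (n + Suc k)\<close>, the tail is dominated by \<open>C\<close> times the
      exponential series, and the dependence on \<open>k\<close> cancels.\<close>
    define C where "C = \<theta> ^ Suc k / fact k"
    have "C > 0" using \<theta> by (simp add: C_def)
    have le: "\<bar>a (n + Suc k)\<bar> \<le> C * (\<theta> ^ n / fact n)" for n
    proof -
      have "fact k * fact n \<le> (fact (k + n) :: nat)"
        by (intro dvd_imp_le fact_fact_dvd_fact) auto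
      also have "\<dots> \<le> fact (n + Suc k)"
        by (intro fact_mono) auto
      finally have *: "fact k * fact n \<le> (fact (n + Suc k) :: real)"
        by (metis of_nat_fact of_nat_le_iff of_nat_mult)
      have "\<bar>a (n + Suc k)\<bar> \<le> 1 * (\<theta> ^ (n + Suc k) / fact (n + Suc k))"
        using f_le[of "n + Suc k"] \<theta> unfolding a_def abs_mult
        by (intro mult_mono) (auto simp del: fact_Suc)
      also have "\<dots> \<le> \<theta> ^ (n + Suc k) / (fact k * fact n)"
        using * \<theta> by (simp only: mult_1_left) (intro divide_left_mono, auto simp del: fact_Suc)
      also have "\<dots> = C * (\<theta> ^ n / fact n)"
        by (simp add: C_def power_add mult.commute)
      finally show ?thesis .
    qed
    have sC: "(\<lambda>n. C * (\<theta> ^ n / fact n)) sums (C * exp \<theta>)"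
      by (intro sums_mult exp_sums)
    have sa: "summable (\<lambda>n. \<bar>a (n + Suc k)\<bar>)"
      by (rule summable_comparison_test_ev[OF _ sums_summable[OF sC]]) (use le in simp)
    have "(\<Sum>i\<le>k. a i) = - (\<Sum>n. a (n + Suc k))"
      using suminf_split_initial_segment[OF sums_summable[OF a_sums], of "Suc k"]
        sums_unique[OF a_sums] by (simp add: lessThan_Suc_atMost)
    then have "\<bar>\<Sum>i\<le>k. a i\<bar> \<le> (\<Sum>n. \<bar>a (n + Suc k)\<bar>)"
      using summable_rabs[OF sa] by simp
    also have "\<dots> \<le> C * exp \<theta>"
      using suminf_le[OF le sa sums_summable[OF sC]] sums_unique[OF sC] by simp
    finally have "\<bar>\<Sum>i\<le>k. a i\<bar> / C \<le> exp \<theta>"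
      using \<open>C > 0\<close> by (simp add: divide_le_eq mult.commute)
    moreover have "\<bar>g (Suc k)\<bar> = \<bar>\<Sum>i\<le>k. a i\<bar> / C"
      using \<theta> by (simp add: g_def C_def abs_mult)
    ultimately show ?thesis
      by simp
  qed
  show ?thesis
  proof (rule that)
    show "\<bar>g k\<bar> \<le> exp \<theta>" for k
      using bound by (cases k) (auto simp: g_def)
    show "\<theta> * g (Suc k) - real k * g k = indicator A k - measure_pmf.prob (poisson_pmf \<theta>) A" for k
    proof (cases k)
      case (Suc j)
      have "\<theta> * g (Suc k) = fact k / \<theta> ^ k * (\<Sum>i\<le>k. a i)"
        using \<theta> by (simp add: g_def)
      also have "\<dots> = fact k / \<theta> ^ k * (\<Sum>i\<le>j. a i) + f k"
        using \<theta> Suc by (simp add: a_def distrib_left del: fact_Suc)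
      also have "fact k / \<theta> ^ k * (\<Sum>i\<le>j. a i) = real k * g k"
        using Suc by (simp add: g_def)
      finally show ?thesis
        by (simp add: f_def P_def)
    qed (use \<theta> in \<open>simp add: g_def a_def f_def P_def\<close>)
  qed
qed

section \<open>Poisson approximation, first and second moment bounds\<close>

context random_subset_family
begin

lemma prob_W: "measure_pmf.prob D {H. W H \<in> A} = expect (\<lambda>H. indicator A (W H))"
proof -
  have "measure_pmf.prob D {H. W H \<in> A} = expect (indicator {H. W H \<in> A})"
    by simp
  also have "indicator {H. W H \<in> A} = (\<lambda>H. indicator A (W H) :: real)"
    by (auto simp: indicator_def)
  finally show ?thesis .
qed

text \<open>Evaluating the Stein equation at \<open>W H\<close> and taking expectations turns the
  difference of probabilities into the quantity controlled by \<open>stein_bound\<close>.\<close>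

lemma poisson_approximation:
  assumes "\<theta> > 0" and "finite A"
  shows "\<bar>measure_pmf.prob D {H. W H \<in> A} - measure_pmf.prob (poisson_pmf \<theta>) A\<bar> \<le>
    exp \<theta> * \<bar>\<theta> - real (card I) * p ^ l\<bar> +
    2 * exp \<theta> * ((\<Sum>\<alpha>\<in>I. real (card (nbhd \<alpha>))) * p ^ (2 * l) +
             (\<Sum>\<alpha>\<in>I. \<Sum>\<beta>\<in>nbhd \<alpha> - {\<alpha>}. p ^ card (E \<alpha> \<union> E \<beta>)))"
proof -
  obtain g :: "nat \<Rightarrow> real" where g: "\<And>k. \<bar>g k\<bar> \<le> exp \<theta>"
    "\<And>k. \<theta> * g (Suc k) - real k * g k = indicator A k - measure_pmf.prob (poisson_pmf \<theta>) A"
    using stein_solution[OF assms] by blast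
  have "measure_pmf.prob D {H. W H \<in> A} - measure_pmf.prob (poisson_pmf \<theta>) A =
      expect (\<lambda>H. \<theta> * g (Suc (W H)) - real (W H) * g (W H))"
    by (simp add: g(2) prob_W)
  then show ?thesis
    using stein_bound[of g, OF g(1), of \<theta>] by simp
qed

text \<open>Markov's inequality for the integer-valued count.\<close>

lemma prob_W_pos: "measure_pmf.prob D {H. W H \<noteq> 0} \<le> real (card I) * p ^ l"
proof -
  have "measure_pmf.prob D {H. W H \<in> - {0}} \<le> expect (\<lambda>H. real (W H))"
    unfolding prob_W by (intro integral_mono) (auto simp: indicator_def)
  then show ?thesis
    by (simp add: expect_W)
qed

text \<open>Chebyshev's inequality, multiplied out so that nothing is divided by the mean: on
  \<open>W H = 0\<close> the squared deviation equals the squared mean. Pairs of disjoint sets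
  contribute at most \<open>\<mu>\<^sup>2\<close> to the second moment, so only neighbours survive
  in the variance.\<close>

lemma prob_W_zero:
  "measure_pmf.prob D {H. W H = 0} * (real (card I) * p ^ l)\<^sup>2 \<le>
     (\<Sum>\<alpha>\<in>I. \<Sum>\<beta>\<in>nbhd \<alpha>. p ^ card (E \<alpha> \<union> E \<beta>))"
proof -
  define \<mu> where "\<mu> = real (card I) * p ^ l"
  have "measure_pmf.prob D {H. W H \<in> {0}} * \<mu>\<^sup>2 = expect (\<lambda>H. indicator {0} (W H) * \<mu>\<^sup>2)"
    unfolding prob_W by simp
  also have "\<dots> \<le> expect (\<lambda>H. (real (W H) - \<mu>)\<^sup>2)"
    by (intro integral_mono) (auto simp: indicator_def)
  also have "\<dots> = expect (\<lambda>H. (real (W H))\<^sup>2 - 2 * \<mu> * real (W H) + \<mu>\<^sup>2)"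
    by (simp add: power2_diff algebra_simps)
  also have "\<dots> = expect (\<lambda>H. (real (W H))\<^sup>2) - \<mu>\<^sup>2"
    by (simp add: expect_W \<mu>_def[symmetric]) (simp add: power2_eq_square)
  also have "expect (\<lambda>H. (real (W H))\<^sup>2) = (\<Sum>\<alpha>\<in>I. \<Sum>\<beta>\<in>I. p ^ card (E \<alpha> \<union> E \<beta>))"
    by (simp add: W_eq power2_eq_square sum_product expect_E2)
  also have "\<dots> \<le> (\<Sum>\<alpha>\<in>I. (\<Sum>\<beta>\<in>nbhd \<alpha>. p ^ card (E \<alpha> \<union> E \<beta>)) + real (card I) * p ^ (2 * l))"
  proof (rule sum_mono)
    fix \<alpha> assume \<alpha>: "\<alpha> \<in> I"
    have "p ^ card (E \<alpha> \<union> E \<beta>) = p ^ (2 * l)" if "\<beta> \<in> I - nbhd \<alpha>" for \<beta>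
      using that \<alpha> card_E[of \<alpha>] card_E[of \<beta>] finite_subset[OF E_subset finite_R]
      by (subst card_Un_disjoint) (auto simp: nbhd_def mult_2)
    then have "(\<Sum>\<beta>\<in>I - nbhd \<alpha>. p ^ card (E \<alpha> \<union> E \<beta>)) = real (card (I - nbhd \<alpha>)) * p ^ (2 * l)"
      by simp
    \<comment> \<open>Overcounting the disjoint pairs by all pairs makes the sum over
      \<open>\<alpha>\<close> exactly \<open>\<mu>\<^sup>2\<close>.\<close>
    also have "\<dots> \<le> real (card I) * p ^ (2 * l)"
      using p_nonneg finite_I by (intro mult_right_mono) (auto intro!: card_mono)
    finally show "(\<Sum>\<beta>\<in>I. p ^ card (E \<alpha> \<union> E \<beta>)) \<le>
        (\<Sum>\<beta>\<in>nbhd \<alpha>. p ^ card (E \<alpha> \<union> E \<beta>)) + real (card I) * p ^ (2 * l)"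
      using sum.subset_diff[OF nbhd_subset finite_I, of "\<lambda>\<beta>. p ^ card (E \<alpha> \<union> E \<beta>)" \<alpha>] by simp
  qed
  also have "\<dots> = (\<Sum>\<alpha>\<in>I. \<Sum>\<beta>\<in>nbhd \<alpha>. p ^ card (E \<alpha> \<union> E \<beta>)) + \<mu>\<^sup>2"
    by (simp add: sum.distrib \<mu>_def power_mult_distrib power2_eq_square mult_2[of l] power_add)
  finally show ?thesis
    by (simp add: \<mu>_def)
qed

end

section \<open>Loose paths as vertex sets\<close>

lemma finite_r_subsets [simp]: "finite (r_subsets r n)"
  by (simp add: r_subsets_def)

lemma card_r_subsets: "card (r_subsets r n) = n choose r"
  unfolding r_subsets_def using n_subsets[of "{1..n}" r] by simp

lemma card_r_subsets_le: "card (r_subsets r n) \<le> n ^ r"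
  unfolding card_r_subsets
  using binomial_le_pow[of r n] by (cases "r \<le> n") (auto simp: binomial_eq_0)

text \<open>Such a \<open>V\<close> is recovered from an \<open>s\<close>-subset \<open>S\<close> of
  \<open>U \<inter> V\<close> and the rest \<open>V - S\<close>. There are at most
  \<open>2 ^ card U\<close> choices for \<open>S\<close>, a constant in \<open>n\<close> when
  \<open>card U\<close> is fixed.\<close>

lemma card_r_subsets_large_inter:
  assumes "finite U" "s \<le> m"
  shows "card {V \<in> r_subsets m n. s \<le> card (U \<inter> V)} \<le> 2 ^ card U * n ^ (m - s)"
proof -
  have "{V \<in> r_subsets m n. s \<le> card (U \<inter> V)} \<subseteq> (\<lambda>(S, T). S \<union> T) ` (Pow U \<times> r_subsets (m - s) n)"
  proof
    fix V assume "V \<in> {V \<in> r_subsets m n. s \<le> card (U \<inter> V)}"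
    then have V: "V \<subseteq> {1..n}" "card V = m" "s \<le> card (U \<inter> V)"
      by (auto simp: r_subsets_def)
    obtain S where S: "S \<subseteq> U \<inter> V" "card S = s"
      using obtain_subset_with_card_n[OF V(3)] by blast
    have "finite S" using S(1) assms(1) finite_subset by blast
    then have "card (V - S) = m - s"
      using S V by (subst card_Diff_subset) auto
    then have "(S, V - S) \<in> Pow U \<times> r_subsets (m - s) n"
      using S V by (auto simp: r_subsets_def)
    moreover have "V = S \<union> (V - S)"
      using S by auto
    ultimately show "V \<in> (\<lambda>(S, T). S \<union> T) ` (Pow U \<times> r_subsets (m - s) n)"
      by (metis (no_types, lifting) case_prod_conv image_eqI)
  qed
  then have "card {V \<in> r_subsets m n. s \<le> card (U \<inter> V)} \<le> card (Pow U \<times> r_subsets (m - s) n)"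
    by (rule surj_card_le[rotated]) (use assms in simp)
  also have "\<dots> = 2 ^ card U * card (r_subsets (m - s) n)"
    using assms by (simp add: card_cartesian_product card_Pow)
  also have "\<dots> \<le> 2 ^ card U * n ^ (m - s)"
    by (intro mult_left_mono card_r_subsets_le) auto
  finally show ?thesis .
qed

text \<open>Without their left endpoints the intervals are pairwise disjoint and have
  \<open>d\<close> elements each; the left endpoint of the first one is an additional point. In
  terms of positions, this is the covering bound for edges of a loose path.\<close>

lemma card_UN_intervals_ge:
  fixes d :: nat
  assumes "finite K" "K \<noteq> {}"
  shows "card K * d + 1 \<le> card (\<Union>k\<in>K. {k * d..(k + 1) * d})"
proof -
  let ?J = "\<Union>k\<in>K. {k * d<..(k + 1) * d}"
  have disj: "{k * d<..(k + 1) * d} \<inter> {k' * d<..(k' + 1) * d} = {}" if "k < k'" for k k'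
  proof -
    have "(k + 1) * d \<le> k' * d"
      using that by (intro mult_right_mono) auto
    then show ?thesis by auto
  qed
  have "card ?J = (\<Sum>k\<in>K. card {k * d<..(k + 1) * d})"
  proof (rule card_UN_disjoint)
    show "\<forall>i\<in>K. \<forall>j\<in>K. i \<noteq> j \<longrightarrow> {i * d<..(i + 1) * d} \<inter> {j * d<..(j + 1) * d} = {}"
      using disj by (metis inf_commute linorder_neqE_nat)
  qed (use assms in auto)
  then have card_J: "card ?J = card K * d"
    by simp
  have "Min K * d \<le> k * d" if "k \<in> K" for k
    using assms that by (intro mult_right_mono) auto
  then have "Min K * d \<notin> ?J"
    by (auto simp: not_less)
  then have "card K * d + 1 = card (insert (Min K * d) ?J)"
    using card_J assms(1) by simp
  also have "\<dots> \<le> card (\<Union>k\<in>K. {k * d..(k + 1) * d})"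
  proof (rule card_mono)
    have "Min K * d \<in> {Min K * d..(Min K + 1) * d}"
      by simp
    then show "insert (Min K * d) ?J \<subseteq> (\<Union>k\<in>K. {k * d..(k + 1) * d})"
      using Min_in[OF assms] by fastforce
  qed (use assms in auto)
  finally show ?thesis .
qed

section \<open>Loose paths encoded by their vertex sets\<close>

definition loose_edge :: "nat \<Rightarrow> nat list \<Rightarrow> nat \<Rightarrow> nat set" where
  "loose_edge r vs k = (\<lambda>i. vs ! i) ` {k * (r - 1)..(k + 1) * (r - 1)}"

text \<open>An increasing sequence is determined by its set of entries, so a vertex set can stand
  for the candidate path and \<open>sorted_list_of_set\<close> restores the order. Counting paths
  becomes counting subsets.\<close>

definition path_edges :: "nat \<Rightarrow> nat \<Rightarrow> nat set \<Rightarrow> nat set set" where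
  "path_edges r l V = loose_edge r (sorted_list_of_set V) ` {..<l}"

abbreviation path_vertex_sets :: "nat \<Rightarrow> nat \<Rightarrow> nat \<Rightarrow> nat set set" where
  "path_vertex_sets r l n \<equiv> r_subsets (l * (r - 1) + 1) n"

lemma ordered_loose_paths_eq:
  "{vs. ordered_loose_path r n H l vs} =
     sorted_list_of_set ` {V \<in> path_vertex_sets r l n. path_edges r l V \<subseteq> H}"
proof (intro equalityI subsetI)
  fix vs assume "vs \<in> {vs. ordered_loose_path r n H l vs}"
  then have vs: "length vs = l * (r - 1) + 1" "set vs \<subseteq> {1..n}" "sorted_wrt (<) vs"
    "\<forall>k<l. loose_edge r vs k \<in> H"
    by (auto simp: ordered_loose_path_def loose_edge_def)
  have "sorted_list_of_set (set vs) = vs" "card (set vs) = length vs"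
    using vs(3) strict_sorted_iff sorted_list_of_set.idem_if_sorted_distinct distinct_card by blast+
  then show "vs \<in> sorted_list_of_set ` {V \<in> path_vertex_sets r l n. path_edges r l V \<subseteq> H}"
    using vs by (intro image_eqI[of _ _ "set vs"]) (auto simp: r_subsets_def path_edges_def)
next
  fix vs assume "vs \<in> sorted_list_of_set ` {V \<in> path_vertex_sets r l n. path_edges r l V \<subseteq> H}"
  then obtain V where V: "vs = sorted_list_of_set V" "V \<subseteq> {1..n}" "card V = l * (r - 1) + 1"
    "path_edges r l V \<subseteq> H"
    by (auto simp: r_subsets_def)
  have "finite V" using V(2) finite_subset by blast
  then show "vs \<in> {vs. ordered_loose_path r n H l vs}"
    using V by (auto simp: ordered_loose_path_def path_edges_def loose_edge_def)
qed

lemma num_ordered_loose_paths_eq: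
  "num_ordered_loose_paths r n l H =
     card {V \<in> path_vertex_sets r l n. path_edges r l V \<subseteq> H}"
proof -
  have "inj_on sorted_list_of_set {V \<in> path_vertex_sets r l n. path_edges r l V \<subseteq> H}"
    by (rule inj_onI)
      (metis (no_types, lifting) finite_atLeastAtMost finite_subset mem_Collect_eq r_subsets_def
        set_sorted_list_of_set)
  then show ?thesis
    unfolding num_ordered_loose_paths_def ordered_loose_paths_eq by (rule card_image)
qed

lemma finite_path_edges: "finite (path_edges r l V)"
  by (simp add: path_edges_def)

context
  fixes r l n :: nat and V :: "nat set"
  assumes r: "r \<ge> 2" and V: "V \<in> path_vertex_sets r l n"
begin

lemma finite_path_vertices: "finite V"
  using V finite_subset[of V "{1..n}"] by (auto simp: r_subsets_def)

lemma inj_on_path_vertices: "inj_on (\<lambda>i. sorted_list_of_set V ! i) {..l * (r - 1)}"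
proof -
  have "length (sorted_list_of_set V) = l * (r - 1) + 1"
    using V by (auto simp: r_subsets_def)
  then show ?thesis
    by (intro inj_onI) (simp add: nth_eq_iff_index_eq)
qed

lemma edge_positions: "k < l \<Longrightarrow> {k * (r - 1)..(k + 1) * (r - 1)} \<subseteq> {..l * (r - 1)}"
  using mult_right_mono[of "k + 1" l "r - 1"] by auto

lemma card_path_edges: "card (path_edges r l V) = l"
proof -
  have "inj_on (loose_edge r (sorted_list_of_set V)) {..<l}"
  proof (rule inj_onI)
    fix k k' assume k: "k \<in> {..<l}" "k' \<in> {..<l}"
      and "loose_edge r (sorted_list_of_set V) k = loose_edge r (sorted_list_of_set V) k'"
    then have "{k * (r - 1)..(k + 1) * (r - 1)} = {k' * (r - 1)..(k' + 1) * (r - 1)}"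
      unfolding loose_edge_def
      using inj_on_image_eq_iff[OF inj_on_path_vertices edge_positions edge_positions] by auto
    \<comment> \<open>Equal intervals have equal left endpoints, and \<open>r - 1 > 0\<close> allows
      cancellation.\<close>
    then have "k * (r - 1) = k' * (r - 1)"
      by (subst (asm) Icc_eq_Icc) auto
    then show "k = k'"
      using r by auto
  qed
  then show ?thesis
    by (simp add: path_edges_def card_image)
qed

lemma loose_edge_subset: "k < l \<Longrightarrow> loose_edge r (sorted_list_of_set V) k \<subseteq> V"
proof -
  assume "k < l"
  then have "loose_edge r (sorted_list_of_set V) k \<subseteq> set (sorted_list_of_set V)"
    using edge_positions[of k] V
    by (auto simp: loose_edge_def r_subsets_def image_subset_iff intro!: nth_mem)
  then show ?thesis
    using finite_path_vertices by simp
qed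

lemma path_edges_subset: "path_edges r l V \<subseteq> r_subsets r n"
proof -
  have "card (loose_edge r (sorted_list_of_set V) k) = r" if "k < l" for k
    unfolding loose_edge_def
    using r card_image[OF inj_on_subset[OF inj_on_path_vertices edge_positions[OF that]]] by simp
  then show ?thesis
    using loose_edge_subset V by (fastforce simp: path_edges_def r_subsets_def)
qed

text \<open>Positions map injectively to vertices, so the bound for unions of intervals carries over
  to unions of edges.\<close>

lemma card_Union_path_edges_ge:
  assumes "F \<subseteq> path_edges r l V" "F \<noteq> {}"
  shows "card F * (r - 1) + 1 \<le> card (\<Union>F)"
proof -
  let ?g = "\<lambda>i. sorted_list_of_set V ! i"
  obtain K where K: "K \<subseteq> {..<l}" "F = loose_edge r (sorted_list_of_set V) ` K"
    using assms(1) unfolding path_edges_def by (meson subset_imageE)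
  have fin: "finite K" and "K \<noteq> {}"
    using K assms(2) finite_subset by auto
  let ?J = "\<Union>k\<in>K. {k * (r - 1)..(k + 1) * (r - 1)}"
  have "\<Union>F = ?g ` ?J"
    using K(2) by (auto simp: loose_edge_def)
  moreover have "?J \<subseteq> {..l * (r - 1)}"
    using K(1) by (intro UN_least edge_positions) auto
  ultimately have "card (\<Union>F) = card ?J"
    using card_image[OF inj_on_subset[OF inj_on_path_vertices]] by simp
  moreover have "card F * (r - 1) \<le> card K * (r - 1)"
    unfolding K(2) using card_image_le[OF fin] by (intro mult_right_mono) auto
  ultimately show ?thesis
    using card_UN_intervals_ge[OF fin \<open>K \<noteq> {}\<close>, of "r - 1"] by linarith
qed

lemma Union_path_edges_subset: "\<Union>(path_edges r l V) \<subseteq> V"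
  using loose_edge_subset by (auto simp: path_edges_def)

text \<open>For all \<open>l\<close> edges together the covering bound already reaches
  \<open>card V\<close>. Hence the edge set determines the path, which fails for
  \<open>l = 0\<close>, where there are no edges.\<close>

lemma Union_path_edges: "l > 0 \<Longrightarrow> \<Union>(path_edges r l V) = V"
  using card_Union_path_edges_ge[of "path_edges r l V"] card_path_edges V
  by (intro card_seteq finite_path_vertices Union_path_edges_subset)
     (auto simp: r_subsets_def path_edges_def)

end

section \<open>Pairs of paths with common edges\<close>

lemma card_paths_sharing_edges_le:
  assumes r: "r \<ge> 2" and V: "V \<in> path_vertex_sets r l n"
    and j: "1 \<le> j" "j \<le> l"
  shows "card {U \<in> path_vertex_sets r l n. j \<le> card (path_edges r l V \<inter> path_edges r l U)}
         \<le> 2 ^ (l * (r - 1) + 1) * n ^ (l * (r - 1) + 1 - (j * (r - 1) + 1))"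
proof -
  have "j * (r - 1) + 1 \<le> card (V \<inter> U)"
    if "U \<in> path_vertex_sets r l n" "j \<le> card (path_edges r l V \<inter> path_edges r l U)" for U
  proof -
    let ?F = "path_edges r l V \<inter> path_edges r l U"
    \<comment> \<open>The common edges are a subfamily of the edges of one path and lie inside both
      vertex sets, so the covering bound forces a large intersection.\<close>
    have "\<Union>?F \<subseteq> V \<inter> U"
      using Union_path_edges_subset[OF r V] Union_path_edges_subset[OF r that(1)] by blast
    then have "card (\<Union>?F) \<le> card (V \<inter> U)"
      using finite_path_vertices[OF r V] by (intro card_mono) auto
    moreover have "card ?F * (r - 1) + 1 \<le> card (\<Union>?F)"
      using that j by (intro card_Union_path_edges_ge[OF r V]) auto
    moreover have "j * (r - 1) \<le> card ?F * (r - 1)"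
      using that by (intro mult_right_mono) auto
    ultimately show ?thesis by linarith
  qed
  then have "{U \<in> path_vertex_sets r l n. j \<le> card (path_edges r l V \<inter> path_edges r l U)} \<subseteq>
      {U \<in> path_vertex_sets r l n. j * (r - 1) + 1 \<le> card (V \<inter> U)}"
    by auto
  then have "card {U \<in> path_vertex_sets r l n. j \<le> card (path_edges r l V \<inter> path_edges r l U)} \<le>
      card {U \<in> path_vertex_sets r l n. j * (r - 1) + 1 \<le> card (V \<inter> U)}"
    by (intro card_mono) auto
  also have "\<dots> \<le> 2 ^ card V * n ^ (l * (r - 1) + 1 - (j * (r - 1) + 1))"
    using j by (intro card_r_subsets_large_inter finite_path_vertices[OF r V]) auto
  finally show ?thesis
    using V by (simp add: r_subsets_def)
qed

text \<open>The paths \<open>U\<close> are grouped by the number \<open>j\<close> of edges shared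
  with \<open>V\<close>, the union then having \<open>2 * l - j\<close> edges. \<open>T\<close>
  stays a parameter because the second moment needs \<open>{1..l}\<close> and the Poisson error only
  \<open>{1..<l}\<close>.\<close>

lemma sum_paths_sharing_edges_le:
  fixes p :: real
  assumes r: "r \<ge> 2" and V: "V \<in> path_vertex_sets r l n"
    and p: "p \<ge> 0" and S: "S \<subseteq> path_vertex_sets r l n" and T: "T \<subseteq> {1..l}"
    and ST: "\<And>U. U \<in> S \<Longrightarrow> card (path_edges r l V \<inter> path_edges r l U) \<in> T"
  shows "(\<Sum>U\<in>S. p ^ card (path_edges r l V \<union> path_edges r l U)) \<le>
     (\<Sum>j\<in>T. 2 ^ (l * (r - 1) + 1) * real n ^ (l * (r - 1) + 1 - (j * (r - 1) + 1)) * p ^ (2 * l - j))"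
proof -
  let ?c = "\<lambda>U. card (path_edges r l V \<inter> path_edges r l U)"
  have fin: "finite S" "finite T"
    using S T finite_subset finite_r_subsets by blast+
  have "(\<Sum>U\<in>S. p ^ card (path_edges r l V \<union> path_edges r l U)) = (\<Sum>U\<in>S. p ^ (2 * l - ?c U))"
  proof (rule sum.cong[OF refl])
    fix U assume "U \<in> S"
    then have "U \<in> path_vertex_sets r l n" using S by auto
    then have "card (path_edges r l V \<union> path_edges r l U) + ?c U = 2 * l"
      using card_Un_Int[OF finite_path_edges finite_path_edges, of r l V r l U]
        card_path_edges[OF r] V by simp
    then show "p ^ card (path_edges r l V \<union> path_edges r l U) = p ^ (2 * l - ?c U)"
      by (metis add_diff_cancel_right')
  qed
  also have "\<dots> = (\<Sum>j\<in>T. \<Sum>U | U \<in> S \<and> ?c U = j. p ^ (2 * l - ?c U))"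
    using fin ST by (intro sum.group[symmetric]) auto
  also have "\<dots> = (\<Sum>j\<in>T. real (card {U \<in> S. ?c U = j}) * p ^ (2 * l - j))"
    by (intro sum.cong refl) simp
  also have "\<dots> \<le> (\<Sum>j\<in>T. 2 ^ (l * (r - 1) + 1) *
      real n ^ (l * (r - 1) + 1 - (j * (r - 1) + 1)) * p ^ (2 * l - j))"
  proof (intro sum_mono mult_right_mono)
    fix j assume "j \<in> T"
    then have j: "1 \<le> j" "j \<le> l" using T by auto
    have "card {U \<in> S. ?c U = j} \<le> card {U \<in> path_vertex_sets r l n. j \<le> ?c U}"
      using S by (intro card_mono) auto
    also note card_paths_sharing_edges_le[OF r V j]
    finally have "real (card {U \<in> S. ?c U = j}) \<le>
        real (2 ^ (l * (r - 1) + 1) * n ^ (l * (r - 1) + 1 - (j * (r - 1) + 1)))"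
      by (rule of_nat_mono)
    then show "real (card {U \<in> S. ?c U = j}) \<le>
        2 ^ (l * (r - 1) + 1) * real n ^ (l * (r - 1) + 1 - (j * (r - 1) + 1))"
      by (simp only: of_nat_mult of_nat_power of_nat_numeral)
  qed (use p in auto)
  finally show ?thesis .
qed

section \<open>Reducing the maximal length to two path counts\<close>

lemma ordered_loose_path_take:
  assumes "ordered_loose_path r n H l' vs" "l \<le> l'"
  shows "ordered_loose_path r n H l (take (l * (r - 1) + 1) vs)"
proof -
  have le: "l * (r - 1) \<le> l' * (r - 1)"
    using assms(2) by (rule mult_right_mono) simp
  have "(\<lambda>i. take (l * (r - 1) + 1) vs ! i) ` {k * (r - 1)..(k + 1) * (r - 1)} =
      (\<lambda>i. vs ! i) ` {k * (r - 1)..(k + 1) * (r - 1)}" if "k < l" for k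
  proof (rule image_cong[OF refl])
    fix i assume "i \<in> {k * (r - 1)..(k + 1) * (r - 1)}"
    then have "i \<le> l * (r - 1)"
      using mult_right_mono[of "k + 1" l "r - 1"] that by auto
    then show "take (l * (r - 1) + 1) vs ! i = vs ! i"
      by simp
  qed
  moreover have "set (take (l * (r - 1) + 1) vs) \<subseteq> set vs"
    by (rule set_take_subset)
  ultimately show ?thesis
    using assms le unfolding ordered_loose_path_def by (auto simp: sorted_wrt_take)
qed

text \<open>Initial segments of paths are paths, so the absence of paths of length
  \<open>Suc l\<close> excludes all longer ones as well.\<close>

lemma l_max_eqI:
  assumes "num_ordered_loose_paths r n l H \<noteq> 0" "num_ordered_loose_paths r n (Suc l) H = 0"
  shows "l_max r n H = l"
proof -
  have "\<exists>vs. ordered_loose_path r n H l vs"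
    using assms(1) by (auto simp: num_ordered_loose_paths_def card_eq_0_iff)
  \<comment> \<open>\<open>card\<close> is 0 on infinite sets too; only with finiteness does a zero
    count mean that there is no path.\<close>
  have "finite {vs. ordered_loose_path r n H (Suc l) vs}"
    unfolding ordered_loose_paths_eq by simp
  then have none: "\<not> ordered_loose_path r n H (Suc l) vs" for vs
    using assms(2) by (auto simp: num_ordered_loose_paths_def)
  have le: "l' \<le> l" if "ordered_loose_path r n H l' vs" for l' vs
    using ordered_loose_path_take[OF that, of "Suc l"] none by (meson not_less_eq_eq)
  then have "{l. \<exists>vs. ordered_loose_path r n H l vs} \<subseteq> {..l}"
    by auto
  then have "finite {l. \<exists>vs. ordered_loose_path r n H l vs}"
    using finite_subset by blast
  then show ?thesis
    unfolding l_max_def using le \<open>\<exists>vs. ordered_loose_path r n H l vs\<close> by (intro Max_eqI) auto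
qed

section \<open>Asymptotics\<close>

lemma random_hypergraph_eq: "random_hypergraph r n p = random_subset (r_subsets r n) p"
  by (simp add: random_hypergraph_def random_subset_def)

lemma random_subset_family_paths:
  assumes "r \<ge> 2" "l > 0" "0 \<le> p" "p \<le> 1"
  shows "random_subset_family (r_subsets r n) p (path_vertex_sets r l n) (path_edges r l) l"
  using assms path_edges_subset card_path_edges by unfold_locales auto

text \<open>The reciprocal of the order of magnitude of the expected number of paths of length
  \<open>j\<close>. Up to a constant, it is the weight of pairs sharing \<open>j\<close> edges
  relative to the squared mean.\<close>

definition overlap :: "nat \<Rightarrow> nat \<Rightarrow> real \<Rightarrow> nat \<Rightarrow> real" where
  "overlap r n p j = 1 / (real n ^ (j * (r - 1) + 1) * p ^ j)"

context
  fixes r l n :: nat and p :: real and m :: nat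
  assumes r: "r \<ge> 2" and l: "l > 0" and n: "n > 0" and p: "0 < p" "p \<le> 1"
  defines "m \<equiv> l * (r - 1) + 1"
begin

interpretation random_subset_family "r_subsets r n" p "r_subsets m n" "path_edges r l" l
  unfolding m_def using r l p by (intro random_subset_family_paths) auto

lemma W_paths: "W H = num_ordered_loose_paths r n l H"
  by (simp only: W_def num_ordered_loose_paths_eq m_def[symmetric])

lemma card_index: "real (card (r_subsets m n)) = real (n choose m)"
  "real (card (r_subsets m n)) \<le> real n ^ m"
  using card_r_subsets_le[of m n] by (simp_all add: card_r_subsets flip: of_nat_power)

lemma power_overlap:
  assumes "j \<le> l"
  shows "real n ^ m * (2 ^ m * real n ^ (m - (j * (r - 1) + 1)) * p ^ (2 * l - j)) =
           2 ^ m * (real n ^ m * p ^ l)\<^sup>2 * overlap r n p j"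
proof -
  have "j * (r - 1) + 1 \<le> m"
    using assms by (simp add: m_def)
  then show ?thesis
    using n p assms
    by (simp add: overlap_def power_diff power_mult_distrib power2_eq_square mult_2[of l] power_add)
qed

lemma sum_overlapping_paths_le:
  assumes "T \<subseteq> {1..l}"
    and "\<And>\<alpha>. \<alpha> \<in> r_subsets m n \<Longrightarrow> S \<alpha> \<subseteq> r_subsets m n"
    and "\<And>\<alpha> \<beta>. \<alpha> \<in> r_subsets m n \<Longrightarrow> \<beta> \<in> S \<alpha> \<Longrightarrow>
            card (path_edges r l \<alpha> \<inter> path_edges r l \<beta>) \<in> T"
  shows "(\<Sum>\<alpha>\<in>r_subsets m n. \<Sum>\<beta>\<in>S \<alpha>. p ^ card (path_edges r l \<alpha> \<union> path_edges r l \<beta>))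
      \<le> 2 ^ m * (real n ^ m * p ^ l)\<^sup>2 * (\<Sum>j\<in>T. overlap r n p j)"
proof -
  let ?s = "\<Sum>j\<in>T. 2 ^ m * real n ^ (m - (j * (r - 1) + 1)) * p ^ (2 * l - j)"
  have "(\<Sum>\<alpha>\<in>r_subsets m n. \<Sum>\<beta>\<in>S \<alpha>. p ^ card (path_edges r l \<alpha> \<union> path_edges r l \<beta>))
      \<le> (\<Sum>\<alpha>\<in>r_subsets m n. ?s)"
    using r p assms
    by (intro sum_mono sum_paths_sharing_edges_le[where r = r and l = l and n = n, folded m_def]) auto
  also have "\<dots> = real (card (r_subsets m n)) * ?s"
    by simp
  also have "\<dots> \<le> real n ^ m * ?s"
    using p by (intro mult_right_mono card_index sum_nonneg) auto
  also have "\<dots> = (\<Sum>j\<in>T. 2 ^ m * (real n ^ m * p ^ l)\<^sup>2 * overlap r n p j)"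
    unfolding sum_distrib_left using assms(1) by (intro sum.cong refl power_overlap) auto
  finally show ?thesis
    by (simp add: sum_distrib_left)
qed

lemma card_inter_nbhd:
  assumes "\<alpha> \<in> r_subsets m n" "\<beta> \<in> nbhd \<alpha>"
  shows "card (path_edges r l \<alpha> \<inter> path_edges r l \<beta>) \<in> {1..l}"
proof -
  have "card (path_edges r l \<alpha> \<inter> path_edges r l \<beta>) \<le> card (path_edges r l \<alpha>)"
    by (intro card_mono finite_path_edges) auto
  moreover have "card (path_edges r l \<alpha> \<inter> path_edges r l \<beta>) \<noteq> 0"
    using assms(2) finite_path_edges by (auto simp: nbhd_def Int_commute)
  ultimately show ?thesis
    using card_path_edges[OF r assms(1)[unfolded m_def]] by simp
qed

text \<open>Sharing all \<open>l\<close> edges would force equal vertex sets. Excluding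
  \<open>j = l\<close> is essential for the Poisson limit, since at the threshold that overlap is a
  nonzero constant.\<close>

lemma card_inter_nbhd_strict:
  assumes "\<alpha> \<in> r_subsets m n" "\<beta> \<in> nbhd \<alpha> - {\<alpha>}"
  shows "card (path_edges r l \<alpha> \<inter> path_edges r l \<beta>) \<in> {1..<l}"
proof -
  have \<beta>: "\<beta> \<in> r_subsets m n"
    using assms(2) nbhd_subset by auto
  have "card (path_edges r l \<alpha> \<inter> path_edges r l \<beta>) \<noteq> l"
  proof
    assume "card (path_edges r l \<alpha> \<inter> path_edges r l \<beta>) = l"
    then have "path_edges r l \<alpha> \<inter> path_edges r l \<beta> = path_edges r l \<alpha>"
      "path_edges r l \<alpha> \<inter> path_edges r l \<beta> = path_edges r l \<beta>"
      using card_path_edges[OF r assms(1)[unfolded m_def]] card_path_edges[OF r \<beta>[unfolded m_def]]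
      by (intro card_subset_eq finite_path_edges; auto)+
    then have "\<alpha> = \<beta>"
      using Union_path_edges[OF r assms(1)[unfolded m_def] l] Union_path_edges[OF r \<beta>[unfolded m_def] l] by metis
    then show False
      using assms(2) by simp
  qed
  then show ?thesis
    using card_inter_nbhd[OF assms(1), of \<beta>] assms(2) by auto
qed

lemma prob_paths_le:
  "measure_pmf.prob (random_hypergraph r n p) {H. num_ordered_loose_paths r n l H \<noteq> 0} \<le>
     real n ^ m * p ^ l"
  using order_trans[OF prob_W_pos mult_right_mono[OF card_index(2)]] p
  by (simp add: random_hypergraph_eq W_paths)

lemma prob_no_paths_le:
  "measure_pmf.prob (random_hypergraph r n p) {H. num_ordered_loose_paths r n l H = 0} *
     (real (n choose m) * p ^ l)\<^sup>2 \<le>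
   2 ^ m * (real n ^ m * p ^ l)\<^sup>2 * (\<Sum>j=1..l. overlap r n p j)"
  using order_trans[OF prob_W_zero sum_overlapping_paths_le[OF subset_refl nbhd_subset card_inter_nbhd]]
  by (simp add: random_hypergraph_eq W_paths card_index)

text \<open>Neighbours share an edge, hence \<open>r\<close> vertices, which saves a factor of order
  \<open>n ^ r\<close> among the pairs; a single factor \<open>n\<close> is kept, as any decay
  suffices.\<close>

lemma sum_card_nbhd_le:
  "(\<Sum>\<alpha>\<in>r_subsets m n. real (card (nbhd \<alpha>))) * p ^ (2 * l) \<le>
     2 ^ m * (real n ^ m * p ^ l)\<^sup>2 / real n"
proof -
  have "real (card (nbhd \<alpha>)) \<le> 2 ^ m * (real n ^ m / real n)" if \<alpha>: "\<alpha> \<in> r_subsets m n" for \<alpha>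
  proof -
    have "card (nbhd \<alpha>) \<le>
        card {U \<in> r_subsets m n. 1 \<le> card (path_edges r l \<alpha> \<inter> path_edges r l U)}"
      using card_inter_nbhd[OF \<alpha>] nbhd_subset by (intro card_mono) auto
    also have "\<dots> \<le> 2 ^ m * n ^ (m - (1 * (r - 1) + 1))"
      using l by (intro card_paths_sharing_edges_le[where r = r and l = l and n = n, folded m_def] r \<alpha>) auto
    also have "\<dots> \<le> 2 ^ m * n ^ (m - 1)"
      using n by (intro mult_left_mono power_increasing) auto
    finally have "real (card (nbhd \<alpha>)) \<le> real (2 ^ m * n ^ (m - 1))"
      by (rule of_nat_mono)
    also have "\<dots> = 2 ^ m * (real n ^ m / real n)"
      using n by (simp add: m_def)
    finally show ?thesis .
  qed
  then have "(\<Sum>\<alpha>\<in>r_subsets m n. real (card (nbhd \<alpha>))) \<le>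
      real (card (r_subsets m n)) * (2 ^ m * (real n ^ m / real n))"
    by (rule sum_bounded_above)
  also have "\<dots> \<le> real n ^ m * (2 ^ m * (real n ^ m / real n))"
    by (intro mult_right_mono card_index) auto
  finally have "(\<Sum>\<alpha>\<in>r_subsets m n. real (card (nbhd \<alpha>))) * p ^ (2 * l) \<le>
      real n ^ m * (2 ^ m * (real n ^ m / real n)) * p ^ (2 * l)"
    using p by (intro mult_right_mono) auto
  also have "\<dots> = 2 ^ m * (real n ^ m * p ^ l)\<^sup>2 / real n"
    by (simp add: power_mult_distrib power2_eq_square mult_2[of l] power_add)
  finally show ?thesis .
qed

lemma paths_poisson_approximation:
  assumes "\<theta> > 0" "finite A"
  shows "\<bar>measure_pmf.prob (random_hypergraph r n p) {H. num_ordered_loose_paths r n l H \<in> A} -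
      measure_pmf.prob (poisson_pmf \<theta>) A\<bar> \<le>
    exp \<theta> * \<bar>\<theta> - real (n choose m) * p ^ l\<bar> +
    2 * exp \<theta> * (2 ^ m * (real n ^ m * p ^ l)\<^sup>2 * (1 / real n + (\<Sum>j=1..<l. overlap r n p j)))"
proof -
  have "(\<Sum>\<alpha>\<in>r_subsets m n. \<Sum>\<beta>\<in>nbhd \<alpha> - {\<alpha>}. p ^ card (path_edges r l \<alpha> \<union> path_edges r l \<beta>))
      \<le> 2 ^ m * (real n ^ m * p ^ l)\<^sup>2 * (\<Sum>j=1..<l. overlap r n p j)"
    using nbhd_subset card_inter_nbhd_strict by (intro sum_overlapping_paths_le) auto
  then have "2 * exp \<theta> * ((\<Sum>\<alpha>\<in>r_subsets m n. real (card (nbhd \<alpha>))) * p ^ (2 * l) +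
        (\<Sum>\<alpha>\<in>r_subsets m n. \<Sum>\<beta>\<in>nbhd \<alpha> - {\<alpha>}.
           p ^ card (path_edges r l \<alpha> \<union> path_edges r l \<beta>))) \<le>
      2 * exp \<theta> * (2 ^ m * (real n ^ m * p ^ l)\<^sup>2 / real n +
        2 ^ m * (real n ^ m * p ^ l)\<^sup>2 * (\<Sum>j=1..<l. overlap r n p j))"
    by (intro mult_left_mono add_mono sum_card_nbhd_le) auto
  then show ?thesis
    using poisson_approximation[OF assms]
    by (simp add: random_hypergraph_eq W_paths card_index distrib_left)
qed

end

section \<open>Limits in \<open>n\<close> and threshold exponents\<close>

lemma binomial_over_power_tendsto:
  "(\<lambda>n. real (n choose m) / real n ^ m) \<longlonglongrightarrow> 1 / fact m"
proof -
  have "(\<lambda>n. (\<Prod>i=0..<m. 1 - real i / real n) / fact m) \<longlonglongrightarrow> (\<Prod>i=0..<m. 1 - 0) / fact m"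
    by (intro tendsto_intros lim_const_over_n) auto
  moreover have "\<forall>\<^sub>F n in sequentially.
      (\<Prod>i=0..<m. 1 - real i / real n) / fact m = real (n choose m) / real n ^ m"
    using eventually_gt_at_top[of 0]
  proof eventually_elim
    case (elim n)
    have "(\<Prod>i=0..<m. 1 - real i / real n) = (\<Prod>i=0..<m. (real n - real i) / real n)"
      using elim by (simp add: diff_divide_distrib)
    also have "\<dots> = (\<Prod>i=0..<m. real n - real i) / real n ^ m"
      by (simp add: prod_dividef)
    also have "(\<Prod>i=0..<m. real n - real i) = real (n choose m) * fact m"
      by (simp add: binomial_gbinomial gbinomial_mult_fact')
    finally show ?case
      by simp
  qed
  ultimately show ?thesis
    using Lim_transform_eventually by force
qed

text \<open>This explains the thresholds: \<open>1 / real n powr (real r - 1 + 1 / real j)\<close>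
  is the value of \<open>p\<close> for which \<open>real n ^ (j * (r - 1) + 1) * p ^ j\<close>
  equals 1.\<close>

lemma powr_exponent_power:
  assumes "n > 0" "j > 0" "r \<ge> 1"
  shows "(real n powr (real r - 1 + 1 / real j)) ^ j = real n ^ (j * (r - 1) + 1)"
proof -
  have "(real n powr (real r - 1 + 1 / real j)) ^ j = real n powr (real j * (real r - 1 + 1 / real j))"
    using assms by (simp add: powr_power mult.commute)
  also have "real j * (real r - 1 + 1 / real j) = real (j * (r - 1) + 1)"
    using assms by (simp add: distrib_left of_nat_diff)
  finally show ?thesis
    using assms by (simp only: powr_realpow of_nat_0_less_iff)
qed

text \<open>Expresses the overlap through the quotient of the threshold for length \<open>j\<close>
  and \<open>p\<close>, the kind of quotient that \<open>much_less\<close> controls.\<close>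

lemma overlap_eq:
  assumes "n > 0" "j > 0" "r \<ge> 1"
  shows "overlap r n p j = (1 / real n powr (real r - 1 + 1 / real j) / p) ^ j"
  unfolding overlap_def powr_exponent_power[OF assms, symmetric]
  by (simp add: power_divide power_mult_distrib)

lemma prob_ge_Diff:
  "1 - measure_pmf.prob M A - measure_pmf.prob M B \<le> measure_pmf.prob M C"
  if "- (A \<union> B) \<subseteq> C"
proof -
  have "1 - measure_pmf.prob M (A \<union> B) = measure_pmf.prob M (- (A \<union> B))"
    using measure_pmf.prob_compl[of "A \<union> B" M] by (simp add: Compl_eq_Diff_UNIV)
  also have "\<dots> \<le> measure_pmf.prob M C"
    using that by (intro measure_pmf.finite_measure_mono) auto
  finally show ?thesis
    using measure_Un_le[of A "measure_pmf M" B] by simp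
qed

section \<open>Concentration of the maximal length\<close>

lemma l_max_aas:
  assumes r: "r \<ge> 2" and l: "l > 0" and p: "\<And>n. 0 \<le> p n \<and> p n \<le> 1"
    and lower: "much_less (\<lambda>n. 1 / real n powr (real r - 1 + 1 / real l)) p"
    and upper: "much_less p (\<lambda>n. 1 / real n powr (real r - 1 + 1 / (real l + 1)))"
  shows "aas (\<lambda>n. random_hypergraph r n (p n)) (\<lambda>n H. l_max r n H = l)"
proof -
  let ?P = "\<lambda>n. measure_pmf.prob (random_hypergraph r n (p n))"
  let ?none = "\<lambda>n. {H. num_ordered_loose_paths r n l H = 0}"
  let ?longer = "\<lambda>n. {H. num_ordered_loose_paths r n (Suc l) H \<noteq> 0}"
  define m where "m = l * (r - 1) + 1"
  \<comment> \<open>The nonvanishing conjunct of \<open>much_less\<close> makes \<open>p n\<close>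
    eventually positive, as the bounds below divide by it.\<close>
  have p_pos: "\<forall>\<^sub>F n in sequentially. p n > 0 \<and> n > 0"
    using conjunct1[OF lower[unfolded much_less_def]] eventually_gt_at_top[of 0]
    by eventually_elim (metis p order_le_imp_less_or_eq)

  \<comment> \<open>The power \<open>Suc l\<close> turns the quotient of the upper hypothesis into
    the first moment bound for paths of length \<open>Suc l\<close>.\<close>
  have "(\<lambda>n. (p n / (1 / real n powr (real r - 1 + 1 / (real l + 1)))) ^ Suc l) \<longlonglongrightarrow> 0 ^ Suc l"
    using upper unfolding much_less_def by (intro tendsto_power) auto
  then have ub0: "(\<lambda>n. (p n / (1 / real n powr (real r - 1 + 1 / (real l + 1)))) ^ Suc l) \<longlonglongrightarrow> 0"
    by simp
  have longer: "(\<lambda>n. ?P n (?longer n)) \<longlonglongrightarrow> 0"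
  proof (rule tendsto_sandwich[OF _ _ tendsto_const ub0])
    show "\<forall>\<^sub>F n in sequentially. ?P n (?longer n) \<le>
        (p n / (1 / real n powr (real r - 1 + 1 / (real l + 1)))) ^ Suc l"
      using p_pos
    proof eventually_elim
      case (elim n)
      have "(p n / (1 / real n powr (real r - 1 + 1 / (real l + 1)))) ^ Suc l =
          real n ^ (Suc l * (r - 1) + 1) * p n ^ Suc l"
        using powr_exponent_power[of n "Suc l" r] elim r
        by (simp add: power_mult_distrib mult.commute add.commute del: power_Suc mult_Suc)
      moreover have "?P n (?longer n) \<le> real n ^ (Suc l * (r - 1) + 1) * p n ^ Suc l"
        using elim p by (intro prob_paths_le r) auto
      ultimately show ?case
        by (simp only:)
    qed
  qed simp

  have "(\<lambda>n. inverse (real (n choose m) / real n ^ m)) \<longlonglongrightarrow> inverse (1 / fact m)"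
    by (intro tendsto_inverse binomial_over_power_tendsto) simp
  then have inv: "(\<lambda>n. real n ^ m / real (n choose m)) \<longlonglongrightarrow> fact m"
    by simp
  \<comment> \<open>For \<open>j \<le> l\<close> the threshold is largest at \<open>j = l\<close>,
    so this one null sequence dominates all overlaps via \<open>q n ^ j\<close>. The exponents start
    at 1, so every term vanishes in the limit.\<close>
  define q where "q = (\<lambda>n. 1 / real n powr (real r - 1 + 1 / real l) / p n)"
  have q: "q \<longlonglongrightarrow> 0"
    using lower unfolding much_less_def q_def by (rule conjunct2)
  have "(\<lambda>n. 2 ^ m * (real n ^ m / real (n choose m))\<^sup>2 * (\<Sum>j=1..l. q n ^ j)) \<longlonglongrightarrow>
      2 ^ m * (fact m)\<^sup>2 * (\<Sum>j=1..l. 0 ^ j)"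
    by (intro tendsto_intros inv q)
  also have "2 ^ m * (fact m)\<^sup>2 * (\<Sum>j=1..l. 0 ^ j) = (0 :: real)"
    by (simp add: sum.neutral)
  finally have ub1: "(\<lambda>n. 2 ^ m * (real n ^ m / real (n choose m))\<^sup>2 * (\<Sum>j=1..l. q n ^ j)) \<longlonglongrightarrow> 0" .
  have none: "(\<lambda>n. ?P n (?none n)) \<longlonglongrightarrow> 0"
  proof (rule tendsto_sandwich[OF _ _ tendsto_const ub1])
    show "\<forall>\<^sub>F n in sequentially. ?P n (?none n) \<le>
        2 ^ m * (real n ^ m / real (n choose m))\<^sup>2 * (\<Sum>j=1..l. q n ^ j)"
      using p_pos eventually_ge_at_top[of m]
    proof eventually_elim
      case (elim n)
      have "overlap r n (p n) j \<le> q n ^ j" if "j \<in> {1..l}" for j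
      proof -
        have "1 / real j \<ge> 1 / real l"
          using that by (intro divide_left_mono) auto
        then have "1 / real n powr (real r - 1 + 1 / real j) \<le> 1 / real n powr (real r - 1 + 1 / real l)"
          using elim by (intro divide_left_mono powr_mono) auto
        then have "1 / real n powr (real r - 1 + 1 / real j) / p n \<le> q n"
          unfolding q_def using elim by (intro divide_right_mono) auto
        then show ?thesis
          using elim that r by (subst overlap_eq) (auto intro!: power_mono)
      qed
      then have "(\<Sum>j=1..l. overlap r n (p n) j) \<le> (\<Sum>j=1..l. q n ^ j)"
        by (intro sum_mono)
      moreover have "?P n (?none n) * (real (n choose m) * p n ^ l)\<^sup>2 \<le>
          2 ^ m * (real n ^ m * p n ^ l)\<^sup>2 * (\<Sum>j=1..l. overlap r n (p n) j)"
        unfolding m_def using elim p by (intro prob_no_paths_le r l) auto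
      ultimately have "?P n (?none n) * (real (n choose m) * p n ^ l)\<^sup>2 \<le>
          2 ^ m * (real n ^ m * p n ^ l)\<^sup>2 * (\<Sum>j=1..l. q n ^ j)"
        by (meson mult_left_mono order_trans zero_le_mult_iff zero_le_numeral zero_le_power zero_le_power2)
      \<comment> \<open>\<open>m \<le> n\<close> keeps the binomial coefficient nonzero. Its ratio
        to \<open>real n ^ m\<close> converges to a positive limit, so the cruder count in the
        numerator costs only a constant.\<close>
      moreover have "(real (n choose m) * p n ^ l)\<^sup>2 > 0"
        using elim by simp
      ultimately have "?P n (?none n) \<le>
          2 ^ m * (real n ^ m * p n ^ l)\<^sup>2 * (\<Sum>j=1..l. q n ^ j) / (real (n choose m) * p n ^ l)\<^sup>2"
        by (simp only: pos_le_divide_eq)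
      also have "\<dots> = 2 ^ m * (real n ^ m / real (n choose m))\<^sup>2 * (\<Sum>j=1..l. q n ^ j)"
        using elim by (simp add: power_mult_distrib power_divide)
      finally show ?case .
    qed
  qed simp

  have "(\<lambda>n. 1 - ?P n (?none n) - ?P n (?longer n)) \<longlonglongrightarrow> 1 - 0 - 0"
    by (intro tendsto_diff tendsto_const none longer)
  then have lb: "(\<lambda>n. 1 - ?P n (?none n) - ?P n (?longer n)) \<longlonglongrightarrow> 1"
    by simp
  show ?thesis
    unfolding aas_def
  proof (rule tendsto_sandwich[OF _ _ lb tendsto_const])
    show "\<forall>\<^sub>F n in sequentially.
        1 - ?P n (?none n) - ?P n (?longer n) \<le> ?P n {H. l_max r n H = l}"
      by (intro always_eventually allI prob_ge_Diff) (auto intro: l_max_eqI)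
  qed simp
qed

section \<open>Poisson convergence at the threshold\<close>

lemma converges_in_distributionI:
  assumes "\<And>A. finite A \<Longrightarrow>
    (\<lambda>n. measure_pmf.prob (M n) {x. X n x \<in> A}) \<longlonglongrightarrow> measure_pmf.prob L A"
  shows "converges_in_distribution M X L"
proof -
  have "(\<lambda>n. cdf (distr (measure_pmf (M n)) borel (\<lambda>x. real (X n x))) t) \<longlonglongrightarrow>
      cdf (distr (measure_pmf L) borel real) t" for t
  proof -
    \<comment> \<open>For counts, a distribution function at \<open>t\<close> is the probability of
      a finite set of naturals, empty for negative \<open>t\<close>. Thus finite \<open>A\<close>,
      as in \<open>stein_solution\<close>, are enough.\<close>
    have "finite {k. real k \<le> t}"
      by (rule finite_subset[of _ "{..nat \<lfloor>t\<rfloor>}"]) (auto simp: le_nat_floor)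
    from assms[OF this] show ?thesis
      by (simp add: cdf_def measure_distr vimage_def)
  qed
  then show ?thesis
    by (simp add: converges_in_distribution_def weak_conv_m_def weak_conv_def)
qed

text \<open>The formula for \<open>p\<close> is required only eventually, because for small
  \<open>n\<close> it may exceed 1 and would not be a probability.\<close>

lemma num_ordered_loose_paths_poisson:
  assumes r: "r \<ge> 2" and l: "l > 0" and c: "c > 0" and p: "\<And>n. 0 \<le> p n \<and> p n \<le> 1"
    and p_eq: "\<forall>\<^sub>F n in sequentially. p n = c / real n powr (real r - 1 + 1 / real l)"
  shows "converges_in_distribution (\<lambda>n. random_hypergraph r n (p n))
           (\<lambda>n H. num_ordered_loose_paths r n l H) (poisson_pmf (c ^ l / fact (l * (r - 1) + 1)))"
proof (rule converges_in_distributionI)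
  fix A :: "nat set" assume A: "finite A"
  let ?P = "\<lambda>n. measure_pmf.prob (random_hypergraph r n (p n))"
  define m where "m = l * (r - 1) + 1"
  define \<theta> where "\<theta> = c ^ l / fact m"
  have \<theta>: "\<theta> > 0"
    using c by (simp add: \<theta>_def)
  \<comment> \<open>At this \<open>p\<close> the quantity \<open>real n ^ m * p n ^ l\<close> is
    exactly \<open>c ^ l\<close>, and each overlap with \<open>j < l\<close> is a constant times a
    negative power of \<open>n\<close>.\<close>
  have p_props: "\<forall>\<^sub>F n in sequentially. n > 0 \<and> p n > 0 \<and> real n ^ m * p n ^ l = c ^ l \<and>
      (\<forall>j\<in>{1..<l}. overlap r n (p n) j = (real n powr (- (1 / real j - 1 / real l)) / c) ^ j)"
    using p_eq eventually_gt_at_top[of 0]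
  proof eventually_elim
    case (elim n)
    have "real n ^ m * p n ^ l = c ^ l"
      unfolding m_def using powr_exponent_power[of n l r] elim r l by (simp add: power_divide)
    moreover have "overlap r n (p n) j = (real n powr (- (1 / real j - 1 / real l)) / c) ^ j"
      if "j \<in> {1..<l}" for j
    proof -
      have "1 / real n powr (real r - 1 + 1 / real j) / p n =
          real n powr (real r - 1 + 1 / real l) / real n powr (real r - 1 + 1 / real j) / c"
        using elim by simp
      also have "\<dots> = real n powr (- (1 / real j - 1 / real l)) / c"
        by (simp add: powr_diff[symmetric])
      finally show ?thesis
        using that elim r by (subst overlap_eq) auto
    qed
    ultimately show ?case
      using elim c by simp
  qed

  define b where "b n = real (n choose m) / real n ^ m" for n
  have b: "b \<longlonglongrightarrow> 1 / fact m"
    unfolding b_def by (rule binomial_over_power_tendsto)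
  \<comment> \<open>The mean is \<open>b n * c ^ l\<close>, which tends to \<open>\<theta>\<close>,
    so the parameter mismatch vanishes along with the neighbourhood and overlap terms.\<close>
  have "(\<lambda>n. exp \<theta> * \<bar>\<theta> - b n * c ^ l\<bar> +
      2 * exp \<theta> * (2 ^ m * (c ^ l)\<^sup>2 * (1 / real n +
        (\<Sum>j=1..<l. (real n powr (- (1 / real j - 1 / real l)) / c) ^ j)))) \<longlonglongrightarrow>
      exp \<theta> * \<bar>\<theta> - 1 / fact m * c ^ l\<bar> +
      2 * exp \<theta> * (2 ^ m * (c ^ l)\<^sup>2 * (0 + (\<Sum>j=1..<l. (0 / c) ^ j)))"
  proof (intro tendsto_intros b lim_const_over_n)
    fix j assume "j \<in> {1..<l}"
    \<comment> \<open>Strictness, from \<open>j < l\<close>, is what makes the exponent of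
      \<open>n\<close> negative.\<close>
    then have "1 / real l < 1 / real j"
      by (intro divide_strict_left_mono) auto
    then show "(\<lambda>n. real n powr (- (1 / real j - 1 / real l))) \<longlonglongrightarrow> 0"
      by (intro tendsto_neg_powr filterlim_real_sequentially) simp
  qed (use c in auto)
  also have "exp \<theta> * \<bar>\<theta> - 1 / fact m * c ^ l\<bar> +
      2 * exp \<theta> * (2 ^ m * (c ^ l)\<^sup>2 * (0 + (\<Sum>j=1..<l. (0 / c) ^ j))) = 0"
    by (simp add: \<theta>_def sum.neutral)
  finally have lim: "(\<lambda>n. exp \<theta> * \<bar>\<theta> - b n * c ^ l\<bar> +
      2 * exp \<theta> * (2 ^ m * (c ^ l)\<^sup>2 * (1 / real n +
        (\<Sum>j=1..<l. (real n powr (- (1 / real j - 1 / real l)) / c) ^ j)))) \<longlonglongrightarrow> 0" .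
  have "(\<lambda>n. ?P n {H. num_ordered_loose_paths r n l H \<in> A} - measure_pmf.prob (poisson_pmf \<theta>) A)
      \<longlonglongrightarrow> 0"
  proof (rule tendsto_rabs_zero_cancel, rule tendsto_sandwich[OF _ _ tendsto_const lim])
    show "\<forall>\<^sub>F n in sequentially.
        \<bar>?P n {H. num_ordered_loose_paths r n l H \<in> A} - measure_pmf.prob (poisson_pmf \<theta>) A\<bar> \<le>
        exp \<theta> * \<bar>\<theta> - b n * c ^ l\<bar> +
        2 * exp \<theta> * (2 ^ m * (c ^ l)\<^sup>2 * (1 / real n +
          (\<Sum>j=1..<l. (real n powr (- (1 / real j - 1 / real l)) / c) ^ j)))"
      using p_props
    proof eventually_elim
      case (elim n)
      have "real (n choose m) * p n ^ l = b n * c ^ l"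
        using elim by (simp add: b_def flip: conjunct1[OF conjunct2[OF conjunct2[OF elim]]])
      moreover have "(\<Sum>j=1..<l. overlap r n (p n) j) =
          (\<Sum>j=1..<l. (real n powr (- (1 / real j - 1 / real l)) / c) ^ j)"
        using elim by (intro sum.cong) auto
      ultimately show ?case
        using paths_poisson_approximation[OF r l, of n "p n" \<theta> A] elim p[of n] \<theta> A
        by (simp only: m_def[symmetric])
    qed
  qed simp
  then show "(\<lambda>n. ?P n {H. num_ordered_loose_paths r n l H \<in> A}) \<longlonglongrightarrow>
      measure_pmf.prob (poisson_pmf (c ^ l / fact (l * (r - 1) + 1))) A"
    unfolding \<theta>_def m_def by (rule LIM_zero_cancel)
qed

theorem theorem1p7:
  fixes r l :: nat
  assumes "r \<ge> 3" and "l \<ge> 2"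
  shows "(\<forall>p :: nat \<Rightarrow> real.
            (\<forall>n. 0 \<le> p n \<and> p n \<le> 1) \<longrightarrow>
            much_less (\<lambda>n. 1 / real n powr (real r - 1 + 1 / real l)) p \<longrightarrow>
            much_less p (\<lambda>n. 1 / real n powr (real r - 1 + 1 / (real l + 1))) \<longrightarrow>
            aas (\<lambda>n. random_hypergraph r n (p n)) (\<lambda>n H. l_max r n H = l)) \<and>
         (\<forall>(c :: real) (p :: nat \<Rightarrow> real).
            c > 0 \<longrightarrow>
            (\<forall>n. 0 \<le> p n \<and> p n \<le> 1) \<longrightarrow>
            (\<forall>\<^sub>F n in sequentially. p n = c / real n powr (real r - 1 + 1 / real l)) \<longrightarrow>
            converges_in_distribution
              (\<lambda>n. random_hypergraph r n (p n))
              (\<lambda>n H. num_ordered_loose_paths r n l H)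
              (poisson_pmf (c ^ l / fact (l * (r - 1) + 1))))"
  using assms by (intro conjI allI impI l_max_aas num_ordered_loose_paths_poisson) auto

end
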